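(* Let $H(A_{\mathbb Z})$ be the ring of Schubert symbols of type $A_{\mathbb Z}$, with Schubert basis $\{\mathcal S_\pi\}$ indexed by finite permutations $\pi$ of $\mathbb Z$, let $\nabla=\sum_{m\in\mathbb Z}m\,M_m$ and $\xi=\sum_{m\in\mathbb Z}M_m$ where $M_m$ are the martial operators, and let $\gamma:H(A_{\mathbb Z})\to\mathbb Q[a,b]$ be the affine-linear genus (all as defined in the context). Let $$e^{a\nabla+b\xi}:H(A_{\mathbb Z})\to\mathbb Q[a,b]\otimes_{\mathbb Z}H(A_{\mathbb Z}),\qquad h\mapsto\sum_{n\ge0}\frac1{n!}(a\nabla+b\xi)^n h,$$ and let $\varepsilon:\mathbb Q[a,b]\otimes_{\mathbb Z}H(A_{\mathbb Z})\to\mathbb Q[a,b]$ be the $\mathbb Q[a,b]$-linear map with $\varepsilon(\mathcal S_\pi)=\delta_{\pi,e}$. Then $$\varepsilon\circ e^{a\nabla+b\xi}=\gamma .$$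
   Context: $W(A_{\mathbb Z})$ is the group of permutations of $\mathbb Z$ moving only finitely many elements, generated by the simple transpositions $r_i=(i\ \ i+1)$, $i\in\mathbb Z$, with Coxeter length $\ell$, Bruhat order $<$, and identity $e$. $H(A_{\mathbb Z})$ is the cohomology ring of the associated infinite flag variety. As a $\mathbb Z$-module it is free on the Schubert symbols $\mathcal S_\pi$, $\pi\in W(A_{\mathbb Z})$. Its multiplication is such that the coefficient of $\mathcal S_\sigma$ in $\mathcal S_\pi\mathcal S_\rho$ equals, for all sufficiently large $N$, the coefficient of the Schubert polynomial $S_{\sigma[N]}$ in $S_{\pi[N]}S_{\rho[N]}$, where $\pi[N](i)=\pi(i-N)+N$ is viewed as a permutation of $\mathbb Z_+$. (The ring structure is not needed to state the equality of maps.) The martial operator $M_m$ ($m\in\mathbb Z$) is the linear operator on $H(A_{\mathbb Z})$ with $M_m\mathcal S_\pi=\mathcal S_{r_m\pi}$ if $r_m\pi<\pi$ and $M_m\mathcal S_\pi=0$ if $r_m\pi>\pi$. The infinite sums defining $\nabla$ and $\xi$ make sense because only finitely many terms are nonzero on a given element. They extend $\mathbb Q[a,b]$-linearly to $\mathbb Q[a,b]\otimes_{\mathbb Z}H(A_{\mathbb Z})$, and they lower the degree $\ell$ by $1$, so the exponential series is a finite sum on each element. For $\pi\in W(A_{\mathbb Z})$, $RW(\pi)$ denotes the set of reduced words of $\pi$: sequences $P=(i_1,\dots,i_{\ell(\pi)})$ of integers with $r_{i_1}r_{i_2}\cdots r_{i_{\ell(\pi)}}=\pi$. The affine-linear genus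 $\gamma$ is the map $$\gamma:H(A_{\mathbb Z})\to\mathbb Q[a,b],\qquad \mathcal S_\pi\mapsto\frac1{\ell(\pi)!}\sum_{P\in RW(\pi)}\ \prod_{i\in P}(ai+b),$$ where the product is over the letters of $P$ with multiplicity. *)

theory Defs
  imports
    "HOL-Combinatorics.Perm"
    "HOL-Library.Poly_Mapping"
    "HOL-Library.Groups_Big_Fun"
    "HOL-Computational_Algebra.Polynomial"
begin

section \<open>The Coxeter group of finitely supported permutations of the integers\<close>

text \<open>
  The library type \<^typ>\<open>int perm\<close> consists of the bijections of the integers that move only
  finitely many elements; its product is composition, so \<open>r m * \<pi>\<close> first applies \<open>\<pi>\<close>.
\<close>

type_synonym W = "int perm"

definition r :: "int \<Rightarrow> W" where
  "r i = Perm.swap i (i + 1)"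

definition word_prod :: "int list \<Rightarrow> W" where
  "word_prod P = prod_list (map r P)"

text \<open>
  The simple transpositions are involutions and generate the group, so every \<open>\<pi>\<close> is the
  product of some word and the minimum below exists.
\<close>

definition cox_length :: "W \<Rightarrow> nat" where
  "cox_length \<pi> = (LEAST n. \<exists>P. length P = n \<and> word_prod P = \<pi>)"

definition RW :: "W \<Rightarrow> int list set" where
  "RW \<pi> = {P. length P = cox_length \<pi> \<and> word_prod P = \<pi>}"

definition reflection :: "W \<Rightarrow> bool" where
  "reflection t \<longleftrightarrow> (\<exists>w i. t = w * r i * inverse w)"

definition bruhat_step :: "W \<Rightarrow> W \<Rightarrow> bool" where
  "bruhat_step u v \<longleftrightarrow> (\<exists>t. reflection t \<and> v = t * u \<and> cox_length u < cox_length v)"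

definition bruhat_less :: "W \<Rightarrow> W \<Rightarrow> bool" where
  "bruhat_less = bruhat_step\<^sup>+\<^sup>+"


section \<open>The module of Schubert symbols and the martial operators\<close>

text \<open>
  Only the additive structure is used: the free abelian group on the Schubert symbols, with
  \<^term>\<open>frag_of \<pi>\<close> playing the role of \<open>S\<^sub>\<pi>\<close>.
\<close>

type_synonym H = "W \<Rightarrow>\<^sub>0 int"

abbreviation schubert :: "W \<Rightarrow> H" where
  "schubert \<pi> \<equiv> frag_of \<pi>"

text \<open>
  For every \<open>m\<close> and \<open>\<pi>\<close>, exactly one of \<open>r m * \<pi> < \<pi>\<close> and \<open>r m * \<pi> > \<pi>\<close> holds, so the
  \<open>else\<close> branch is the case \<open>r m * \<pi> > \<pi>\<close>.
\<close>

definition martial :: "int \<Rightarrow> H \<Rightarrow> H" where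
  "martial m = frag_extend (\<lambda>\<pi>. if bruhat_less (r m * \<pi>) \<pi> then schubert (r m * \<pi>) else 0)"

text \<open>
  \<^const>\<open>Sum_any\<close> adds up the nonzero summands. It returns \<open>0\<close> when there are infinitely many of
  them, which does not happen here: \<open>martial m (schubert \<pi>)\<close> is nonzero exactly
  when \<open>\<pi>\<inverse>\<close> has a descent at \<open>m\<close>, hence for finitely many \<open>m\<close>.
\<close>

definition nabla :: "H \<Rightarrow> H" where
  "nabla h = Sum_any (\<lambda>m. frag_cmul m (martial m h))"

definition xi :: "H \<Rightarrow> H" where
  "xi h = Sum_any (\<lambda>m. martial m h)"


section \<open>Extension of scalars to the bivariate rational polynomials\<close>

text \<open>
  \<^typ>\<open>rat poly poly\<close> is the polynomial ring in \<open>b\<close> over the polynomial ring in \<open>a\<close>. The tensor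
  product of \<open>\<rat>[a,b]\<close> with the free abelian group \<open>H\<close> is the free \<open>\<rat>[a,b]\<close>-module on
  the same basis.
\<close>

type_synonym Qab = "rat poly poly"
type_synonym HQ = "W \<Rightarrow>\<^sub>0 Qab"

definition var_a :: Qab where "var_a = [:[:0, 1:]:]"

definition var_b :: Qab where "var_b = [:0, 1:]"

definition const_Qab :: "rat \<Rightarrow> Qab" where "const_Qab q = [:[:q:]:]"

definition scale :: "Qab \<Rightarrow> HQ \<Rightarrow> HQ" where
  "scale p = Poly_Mapping.map ((*) p)"

text \<open>The canonical map \<open>h \<mapsto> 1 \<otimes> h\<close>\<close>

definition embed :: "H \<Rightarrow> HQ" where
  "embed = Poly_Mapping.map of_int"

text \<open>The \<open>\<rat>[a,b]\<close>-linear extension of an additive map\<close>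

definition extend_scalars :: "(H \<Rightarrow> H) \<Rightarrow> HQ \<Rightarrow> HQ" where
  "extend_scalars T x =
     (\<Sum>\<pi>\<in>Poly_Mapping.keys x. scale (Poly_Mapping.lookup x \<pi>) (embed (T (schubert \<pi>))))"

definition a_nabla_b_xi :: "HQ \<Rightarrow> HQ" where
  "a_nabla_b_xi x =
     scale var_a (extend_scalars nabla x) + scale var_b (extend_scalars xi x)"

text \<open>
  Only finitely many summands are nonzero: the operator lowers the length of the basis
  elements by one.
\<close>

definition exp_a_nabla_b_xi :: "H \<Rightarrow> HQ" where
  "exp_a_nabla_b_xi h =
     Sum_any (\<lambda>n::nat. scale (const_Qab (1 / fact n)) ((a_nabla_b_xi ^^ n) (embed h)))"

definition counit :: "HQ \<Rightarrow> Qab" where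
  "counit x =
     (\<Sum>\<pi>\<in>Poly_Mapping.keys x. Poly_Mapping.lookup x \<pi> * (if \<pi> = 1 then 1 else 0))"


section \<open>The affine-linear genus\<close>

definition genus_schubert :: "W \<Rightarrow> Qab" where
  "genus_schubert \<pi> =
     const_Qab (1 / fact (cox_length \<pi>)) *
     (\<Sum>P\<in>RW \<pi>. \<Prod>i\<leftarrow>P. var_a * of_int i + var_b)"

definition genus :: "H \<Rightarrow> Qab" where
  "genus h =
     (\<Sum>\<pi>\<in>Poly_Mapping.keys h. of_int (Poly_Mapping.lookup h \<pi>) * genus_schubert \<pi>)"

end

theory Submission
  imports Defs
begin

text \<open>
  Put \<open>T = a\<nabla> + b\<xi>\<close>. Then \<open>T S\<^sub>\<pi>\<close> is the sum of \<open>(am + b) S\<^bsub>r\<^sub>m \<pi>\<^esub>\<close> over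
  the left descents \<open>m\<close> of \<open>\<pi>\<close>, which are the possible first letters of reduced words of
  \<open>\<pi>\<close>. Hence the coefficient of \<open>S\<^sub>e\<close> in \<open>T\<^sup>n S\<^sub>\<pi>\<close> is the weighted count of
  reduced words if \<open>n\<close> is the length of \<open>\<pi>\<close>, and \<open>0\<close> otherwise. Identifying the length
  with the number of inversions shows that there are only finitely many descents.
\<close>

section \<open>Inversions and length\<close>

unbundle permutation_syntax

definition inversions :: "int perm \<Rightarrow> (int \<times> int) set" where
  "inversions \<sigma> = {(i, j). i < j \<and> \<sigma> \<langle>$\<rangle> j < \<sigma> \<langle>$\<rangle> i}"

lemma affected_bounded:
  fixes \<sigma> :: "int perm"
  obtains N where "\<And>i. N < \<bar>i\<bar> \<Longrightarrow> \<sigma> \<langle>$\<rangle> i = i"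
proof -
  have "\<sigma> \<langle>$\<rangle> i = i" if "Max (insert 0 (abs ` affected \<sigma>)) < \<bar>i\<bar>" for i
  proof (rule ccontr)
    assume "\<sigma> \<langle>$\<rangle> i \<noteq> i"
    then have "\<bar>i\<bar> \<le> Max (insert 0 (abs ` affected \<sigma>))"
      by (intro Max_ge) (auto simp: in_affected)
    with that show False by linarith
  qed
  then show thesis by (rule that)
qed

lemma finite_inversions [simp]: "finite (inversions \<sigma>)"
proof -
  obtain N where N: "\<And>i. N < \<bar>i\<bar> \<Longrightarrow> \<sigma> \<langle>$\<rangle> i = i"
    using affected_bounded by blast
  have "-N \<le> i \<and> j \<le> N" if "(i, j) \<in> inversions \<sigma>" for i j
  proof -
    have ij: "i < j" "\<sigma> \<langle>$\<rangle> j < \<sigma> \<langle>$\<rangle> i"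
      using that by (auto simp: inversions_def)
    have "-N \<le> i"
    proof (rule ccontr)
      assume "\<not> -N \<le> i"
      \<comment> \<open>Both \<open>i\<close> and the image of \<open>j\<close>, which is smaller
        still, lie in the fixed range below \<open>-N\<close>; injectivity then forces
        \<open>j\<close> to be fixed, although its image is below \<open>i < j\<close>.\<close>
      then have "\<sigma> \<langle>$\<rangle> i = i" and "\<sigma> \<langle>$\<rangle> (\<sigma> \<langle>$\<rangle> j) = \<sigma> \<langle>$\<rangle> j"
        using N[of i] N[of "\<sigma> \<langle>$\<rangle> j"] ij by linarith+
      then show False using ij by (simp add: apply_inj)
    qed
    moreover have "j \<le> N"
    proof (rule ccontr)
      assume "\<not> j \<le> N"
      then have "\<sigma> \<langle>$\<rangle> j = j" and "\<sigma> \<langle>$\<rangle> (\<sigma> \<langle>$\<rangle> i) = \<sigma> \<langle>$\<rangle> i"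
        using N[of j] N[of "\<sigma> \<langle>$\<rangle> i"] ij by linarith+
      then show False using ij by (simp add: apply_inj)
    qed
    ultimately show ?thesis by simp
  qed
  then have "inversions \<sigma> \<subseteq> {-N..N} \<times> {-N..N}"
    by (force simp: inversions_def)
  then show ?thesis by (rule finite_subset) simp
qed

lemma inversions_one [simp]: "inversions 1 = {}"
  by (auto simp: inversions_def)

section \<open>Inversions under a simple transposition\<close>

lemma apply_r: "r m \<langle>$\<rangle> i = (if i = m then m + 1 else if i = m + 1 then m else i)"
  by (simp add: r_def)

lemma r_r_mult [simp]: "r m * (r m * \<pi>) = \<pi>"
  by (rule perm_eqI) (simp add: apply_times apply_r)

lemma mult_r_r [simp]: "\<pi> * r m * r m = \<pi>"
  by (rule perm_eqI) (simp add: apply_times apply_r)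

lemma inverse_r [simp]: "inverse (r m) = r m"
  by (rule perm.inverse_unique, rule perm_eqI) (simp add: apply_times apply_r)

text \<open>Exchanging the adjacent positions \<open>m\<close> and \<open>m + 1\<close> preserves
  the relative order of every other pair of positions, so only this pair changes status.\<close>

lemma inversions_mult_r:
  assumes "\<sigma> \<langle>$\<rangle> m < \<sigma> \<langle>$\<rangle> (m + 1)"
  shows "inversions (\<sigma> * r m) =
    insert (m, m + 1) (map_prod (apply (r m)) (apply (r m)) ` inversions \<sigma>)"
proof (intro equalityI subsetI)
  have inv: "map_prod (apply (r m)) (apply (r m)) (r m \<langle>$\<rangle> i, r m \<langle>$\<rangle> j) = (i, j)" for i j
    by (simp add: apply_r)
  fix p
  assume p: "p \<in> inversions (\<sigma> * r m)"
  obtain i j where ij: "p = (i, j)" by (cases p)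
  show "p \<in> insert (m, m + 1) (map_prod (apply (r m)) (apply (r m)) ` inversions \<sigma>)"
  proof (cases "p = (m, m + 1)")
    case False
    with p have "(r m \<langle>$\<rangle> i, r m \<langle>$\<rangle> j) \<in> inversions \<sigma>"
      by (auto simp: ij inversions_def apply_times apply_r split: if_splits)
    then show ?thesis by (metis imageI insertI2 inv ij)
  qed simp
next
  have "map_prod (apply (r m)) (apply (r m)) (i, j) \<in> inversions (\<sigma> * r m)"
    if "(i, j) \<in> inversions \<sigma>" for i j
    using that assms by (auto simp: inversions_def apply_times apply_r)
  moreover have "(m, m + 1) \<in> inversions (\<sigma> * r m)"
    using assms by (simp add: inversions_def apply_times apply_r)
  ultimately show "p \<in> inversions (\<sigma> * r m)"
    if "p \<in> insert (m, m + 1) (map_prod (apply (r m)) (apply (r m)) ` inversions \<sigma>)" for p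
    using that by auto
qed

lemma card_inversions_ascent:
  assumes "\<sigma> \<langle>$\<rangle> m < \<sigma> \<langle>$\<rangle> (m + 1)"
  shows "card (inversions (\<sigma> * r m)) = Suc (card (inversions \<sigma>))"
proof -
  have "(m, m + 1) \<notin> map_prod (apply (r m)) (apply (r m)) ` inversions \<sigma>"
    by (auto simp: inversions_def apply_r split: if_splits)
  moreover have "inj_on (map_prod (apply (r m)) (apply (r m))) (inversions \<sigma>)"
    by (auto simp: inj_on_def apply_inj)
  ultimately show ?thesis
    using inversions_mult_r[OF assms] by (simp add: card_image)
qed

text \<open>This is the ascent case for \<open>\<sigma> * r m\<close>, since \<open>r m\<close> is
  an involution.\<close>

lemma card_inversions_descent:
  assumes "\<sigma> \<langle>$\<rangle> (m + 1) < \<sigma> \<langle>$\<rangle> m"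
  shows "Suc (card (inversions (\<sigma> * r m))) = card (inversions \<sigma>)"
  using card_inversions_ascent[of "\<sigma> * r m" m] assms by (simp add: apply_times apply_r)

text \<open>Without descents the integer values strictly increase, so the displacement of
  \<open>i\<close> is nondecreasing in \<open>i\<close>; it vanishes far out on both sides.\<close>

lemma no_descent_imp_one:
  fixes \<sigma> :: "int perm"
  assumes "\<And>m. \<not> \<sigma> \<langle>$\<rangle> (m + 1) < \<sigma> \<langle>$\<rangle> m"
  shows "\<sigma> = 1"
proof -
  obtain N where N: "\<And>i. N < \<bar>i\<bar> \<Longrightarrow> \<sigma> \<langle>$\<rangle> i = i"
    using affected_bounded by blast
  have step: "\<sigma> \<langle>$\<rangle> m - m \<le> \<sigma> \<langle>$\<rangle> (m + 1) - (m + 1)" for m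
    using assms[of m] apply_inj[of \<sigma> m "m + 1"] by linarith
  have mono: "\<sigma> \<langle>$\<rangle> i - i \<le> \<sigma> \<langle>$\<rangle> j - j" if "i \<le> j" for i j
    using that by (induction rule: int_ge_induct) (auto intro: order.trans[OF _ step])
  have "\<sigma> \<langle>$\<rangle> i = i" for i
    \<comment> \<open>The two comparison points lie on either side of \<open>i\<close> and beyond
      the bound \<open>N\<close>, hence are fixed.\<close>
    using mono[of i "\<bar>i\<bar> + \<bar>N\<bar> + 1"] mono[of "- \<bar>i\<bar> - \<bar>N\<bar> - 1" i]
      N[of "\<bar>i\<bar> + \<bar>N\<bar> + 1"] N[of "- \<bar>i\<bar> - \<bar>N\<bar> - 1"] by linarith
  then show ?thesis by (simp add: perm_eq_iff)
qed

text \<open>Left descents. The inverse turns left multiplication by \<open>r m\<close> into right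
  multiplication, to which the inversion counts above apply.\<close>

definition descents :: "W \<Rightarrow> int set" where
  "descents \<pi> = {m. inverse \<pi> \<langle>$\<rangle> (m + 1) < inverse \<pi> \<langle>$\<rangle> m}"

lemma finite_descents [simp]: "finite (descents \<pi>)"
proof -
  have "(\<lambda>m. (m, m + 1)) ` descents \<pi> \<subseteq> inversions (inverse \<pi>)"
    by (auto simp: descents_def inversions_def)
  then have "finite ((\<lambda>m. (m, m + 1)) ` descents \<pi>)"
    by (rule finite_subset) simp
  then show ?thesis by (rule finite_imageD) (simp add: inj_on_def)
qed

section \<open>Coxeter length as a number of inversions\<close>

lemma word_prod_Nil [simp]: "word_prod [] = 1"
  and word_prod_Cons [simp]: "word_prod (m # P) = r m * word_prod P"
  by (simp_all add: word_prod_def)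

text \<open>The subtraction is exact: off the descents, passing to \<open>r m * \<pi>\<close>
  creates one inversion.\<close>

lemma card_inversions_r_mult:
  "card (inversions (inverse \<pi>)) =
    (if m \<in> descents \<pi> then Suc (card (inversions (inverse (r m * \<pi>))))
     else card (inversions (inverse (r m * \<pi>))) - 1)"
  using card_inversions_ascent[of "inverse \<pi>" m] card_inversions_descent[of "inverse \<pi>" m]
    apply_inj[of "inverse \<pi>" m "m + 1"]
  by (auto simp: descents_def)

lemma card_inversions_word_prod:
  "card (inversions (inverse (word_prod P))) \<le> length P"
proof (induction P)
  case (Cons m P)
  then show ?case
    using card_inversions_r_mult[of "word_prod P" m] by (auto split: if_splits)
qed simp

text \<open>Bubble sort: stripping a left descent removes one inversion, until only the identity is
  left. Together with the preceding lower bound this determines the minimum in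
  \<open>cox_length\<close>.\<close>

lemma exists_word:
  "\<exists>P. length P = card (inversions (inverse \<pi>)) \<and> word_prod P = \<pi>"
proof (induction "card (inversions (inverse \<pi>))" arbitrary: \<pi> rule: less_induct)
  case less
  show ?case
  proof (cases "descents \<pi> = {}")
    case True
    then have "inverse \<pi> = 1"
      by (intro no_descent_imp_one) (auto simp: descents_def)
    then have "\<pi> = 1" by (metis perm.inverse_inverse perm.inverse_neutral)
    then show ?thesis by (intro exI[of _ "[]"]) simp
  next
    case False
    then obtain m where m: "m \<in> descents \<pi>" by blast
    then have card: "card (inversions (inverse \<pi>)) = Suc (card (inversions (inverse (r m * \<pi>))))"
      using card_inversions_r_mult[of \<pi> m] by simp
    then obtain P where "length P = card (inversions (inverse (r m * \<pi>)))" "word_prod P = r m * \<pi>"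
      using less[of "r m * \<pi>"] by auto
    with card show ?thesis by (intro exI[of _ "m # P"]) simp
  qed
qed

lemma cox_length_eq_card_inversions: "cox_length \<pi> = card (inversions (inverse \<pi>))"
  unfolding cox_length_def
  by (rule Least_equality) (use exists_word card_inversions_word_prod in auto)

lemma cox_length_one [simp]: "cox_length 1 = 0"
  by (simp add: cox_length_eq_card_inversions)

lemma cox_length_eq_0_iff [simp]: "cox_length \<pi> = 0 \<longleftrightarrow> \<pi> = 1"
  using exists_word[of \<pi>] by (auto simp: cox_length_eq_card_inversions)

lemma cox_length_descent: "m \<in> descents \<pi> \<Longrightarrow> cox_length \<pi> = Suc (cox_length (r m * \<pi>))"
  using card_inversions_r_mult[of \<pi> m] by (simp add: cox_length_eq_card_inversions)

lemma descents_iff: "m \<in> descents \<pi> \<longleftrightarrow> cox_length (r m * \<pi>) < cox_length \<pi>"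
  using card_inversions_r_mult[of \<pi> m] by (auto simp: cox_length_eq_card_inversions)

text \<open>Length strictly increases along Bruhat chains; conversely a descent gives a one-step
  chain, because \<open>r m\<close> is itself a reflection.\<close>

lemma bruhat_less_r_mult_iff: "bruhat_less (r m * \<pi>) \<pi> \<longleftrightarrow> m \<in> descents \<pi>"
proof
  have "cox_length u < cox_length v" if "bruhat_step\<^sup>+\<^sup>+ u v" for u v
    using that by induction (auto simp: bruhat_step_def)
  then show "bruhat_less (r m * \<pi>) \<pi> \<Longrightarrow> m \<in> descents \<pi>"
    by (auto simp: bruhat_less_def descents_iff)
next
  assume "m \<in> descents \<pi>"
  moreover have "reflection (r m)"
    unfolding reflection_def by (intro exI[of _ 1] exI[of _ m]) simp
  ultimately have "bruhat_step (r m * \<pi>) \<pi>"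
    unfolding bruhat_step_def by (intro exI[of _ "r m"]) (simp add: descents_iff)
  then show "bruhat_less (r m * \<pi>) \<pi>"
    unfolding bruhat_less_def by blast
qed

section \<open>Reduced words\<close>

lemma RW_one: "RW 1 = {[]}"
  by (auto simp: RW_def)

lemma Cons_in_RW_iff: "m # P \<in> RW \<pi> \<longleftrightarrow> m \<in> descents \<pi> \<and> P \<in> RW (r m * \<pi>)"
proof
  assume "m # P \<in> RW \<pi>"
  then have *: "Suc (length P) = cox_length \<pi>" "r m * word_prod P = \<pi>"
    by (simp_all add: RW_def)
  then have prod: "word_prod P = r m * \<pi>" by auto
  \<comment> \<open>The tail has one letter less than \<open>cox_length \<pi>\<close>, so this bound
    makes \<open>m\<close> a descent; the drop is then exactly one and the tail is reduced.\<close>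
  moreover have "cox_length (r m * \<pi>) \<le> length P"
    using card_inversions_word_prod[of P] by (simp add: prod cox_length_eq_card_inversions)
  ultimately show "m \<in> descents \<pi> \<and> P \<in> RW (r m * \<pi>)"
    using * cox_length_descent[of m \<pi>] by (auto simp: RW_def descents_iff)
next
  assume "m \<in> descents \<pi> \<and> P \<in> RW (r m * \<pi>)"
  then show "m # P \<in> RW \<pi>"
    by (simp add: RW_def cox_length_descent[of m])
qed

lemma RW_unfold:
  assumes "\<pi> \<noteq> 1"
  shows "RW \<pi> = (\<lambda>(m, P). m # P) ` (SIGMA m:descents \<pi>. RW (r m * \<pi>))"
proof (rule set_eqI)
  fix P
  show "P \<in> RW \<pi> \<longleftrightarrow> P \<in> (\<lambda>(m, P). m # P) ` (SIGMA m:descents \<pi>. RW (r m * \<pi>))"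
    using assms by (cases P) (auto simp: Cons_in_RW_iff, auto simp: RW_def)
qed

lemma finite_RW [simp]: "finite (RW \<pi>)"
proof (induction "cox_length \<pi>" arbitrary: \<pi> rule: less_induct)
  case less
  show ?case
  proof (cases "\<pi> = 1")
    case False
    have "finite (RW (r m * \<pi>))" if "m \<in> descents \<pi>" for m
      using less that by (simp add: descents_iff)
    then show ?thesis unfolding RW_unfold[OF False] by simp
  qed (simp add: RW_one)
qed

text \<open>The genus of \<open>schubert \<pi>\<close> without its factorial denominator.\<close>

definition RW_weight :: "W \<Rightarrow> Qab" where
  "RW_weight \<pi> = (\<Sum>P\<in>RW \<pi>. \<Prod>i\<leftarrow>P. var_a * of_int i + var_b)"

lemma RW_weight_one: "RW_weight 1 = 1"
  by (simp add: RW_weight_def RW_one)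

text \<open>Grouping reduced words by first letter gives the same recursion as one application of
  \<open>a_nabla_b_xi\<close> to a basis element.\<close>

lemma RW_weight_unfold:
  assumes "\<pi> \<noteq> 1"
  shows "RW_weight \<pi> = (\<Sum>m\<in>descents \<pi>. (var_a * of_int m + var_b) * RW_weight (r m * \<pi>))"
proof -
  have "RW_weight \<pi> = (\<Sum>(m, P)\<in>(SIGMA m:descents \<pi>. RW (r m * \<pi>)).
      (var_a * of_int m + var_b) * (\<Prod>i\<leftarrow>P. var_a * of_int i + var_b))"
    unfolding RW_weight_def RW_unfold[OF assms]
    by (subst sum.reindex) (auto simp: inj_on_def case_prod_unfold)
  also have "\<dots> = (\<Sum>m\<in>descents \<pi>. \<Sum>P\<in>RW (r m * \<pi>).
      (var_a * of_int m + var_b) * (\<Prod>i\<leftarrow>P. var_a * of_int i + var_b))"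
    by (subst sum.Sigma) auto
  finally show ?thesis by (simp add: RW_weight_def sum_distrib_left)
qed

section \<open>Linearity\<close>

lemma lookup_scale [simp]: "Poly_Mapping.lookup (scale p x) k = p * Poly_Mapping.lookup x k"
  by (simp add: scale_def Poly_Mapping.map.rep_eq when_def)

lemma lookup_embed [simp]:
  "Poly_Mapping.lookup (embed h) k = of_int (Poly_Mapping.lookup h k)"
  by (simp add: embed_def Poly_Mapping.map.rep_eq when_def)

lemma scale_zero [simp]: "scale p 0 = 0"
  and scale_zero_left [simp]: "scale 0 x = 0"
  and scale_one [simp]: "scale 1 x = x"
  and scale_scale: "scale p (scale q x) = scale (p * q) x"
  by (rule poly_mapping_eqI; simp add: mult.assoc)+

lemma scale_add: "scale p (x + y) = scale p x + scale p y"
  and scale_add_left: "scale (p + q) x = scale p x + scale q x"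
  by (rule poly_mapping_eqI; simp add: lookup_add algebra_simps)+

lemma scale_sum: "scale p (sum f A) = (\<Sum>i\<in>A. scale p (f i))"
  by (rule poly_mapping_eqI) (simp add: lookup_sum sum_distrib_left)

lemma embed_sum: "embed (sum f A) = (\<Sum>i\<in>A. embed (f i))"
  by (rule poly_mapping_eqI) (simp add: lookup_sum)

lemma embed_frag_cmul: "embed (frag_cmul c h) = scale (of_int c) (embed h)"
  by (rule poly_mapping_eqI) simp

definition basis :: "W \<Rightarrow> HQ" where
  "basis \<pi> = Poly_Mapping.single \<pi> 1"

lemma lookup_basis: "Poly_Mapping.lookup (basis \<pi>) k = (if k = \<pi> then 1 else 0)"
  by (simp add: basis_def lookup_single when_def)

lemma embed_schubert: "embed (schubert \<pi>) = basis \<pi>"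
  by (rule poly_mapping_eqI) (simp add: lookup_basis)

lemma embed_expand:
  "embed h = (\<Sum>\<pi>\<in>Poly_Mapping.keys h. scale (of_int (Poly_Mapping.lookup h \<pi>)) (basis \<pi>))"
  by (rule poly_mapping_eqI)
    (auto simp: lookup_sum lookup_basis if_distrib if_distribR in_keys_iff cong: if_cong)

text \<open>Lets sums over different key sets share one index set, since adding or scaling may
  cancel keys.\<close>

lemma extend_scalars_superset:
  assumes "finite A" "Poly_Mapping.keys x \<subseteq> A"
  shows "extend_scalars T x =
    (\<Sum>\<pi>\<in>A. scale (Poly_Mapping.lookup x \<pi>) (embed (T (schubert \<pi>))))"
  unfolding extend_scalars_def
  by (rule sum.mono_neutral_left) (use assms in \<open>auto simp: in_keys_iff\<close>)

lemma extend_scalars_add: "extend_scalars T (x + y) = extend_scalars T x + extend_scalars T y"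
proof -
  define A where "A = Poly_Mapping.keys x \<union> Poly_Mapping.keys y"
  have "finite A" "Poly_Mapping.keys x \<subseteq> A" "Poly_Mapping.keys y \<subseteq> A"
    "Poly_Mapping.keys (x + y) \<subseteq> A"
    using Poly_Mapping.keys_add[of x y] by (auto simp: A_def)
  then show ?thesis
    by (simp add: extend_scalars_superset[of A] lookup_add scale_add_left sum.distrib)
qed

lemma extend_scalars_scale: "extend_scalars T (scale p x) = scale p (extend_scalars T x)"
proof -
  have "Poly_Mapping.keys (scale p x) \<subseteq> Poly_Mapping.keys x"
    by (auto simp: in_keys_iff)
  then show ?thesis
    by (simp add: extend_scalars_superset[of "Poly_Mapping.keys x"] scale_sum scale_scale)
qed

lemma extend_scalars_basis: "extend_scalars T (basis \<pi>) = embed (T (schubert \<pi>))"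
  by (simp add: extend_scalars_def basis_def)

definition linear_HQ :: "(HQ \<Rightarrow> HQ) \<Rightarrow> bool" where
  "linear_HQ f \<longleftrightarrow> (\<forall>x y. f (x + y) = f x + f y) \<and> (\<forall>p x. f (scale p x) = scale p (f x))"

lemma linear_HQ_scale: "linear_HQ f \<Longrightarrow> f (scale p x) = scale p (f x)"
  by (simp add: linear_HQ_def)

lemma linear_HQ_sum:
  assumes "linear_HQ f"
  shows "f (sum g A) = (\<Sum>i\<in>A. f (g i))"
proof (induction A rule: infinite_finite_induct)
  have "f 0 = 0"
    using linear_HQ_scale[OF assms, of 0 0] by simp
  then show "f (sum g {}) = (\<Sum>i\<in>{}. f (g i))" by simp
  \<comment> \<open>A sum over an infinite set is 0 by convention, so \<open>f 0 = 0\<close> settles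
    this case too.\<close>
  then show "f (sum g A) = (\<Sum>i\<in>A. f (g i))" if "infinite A" for A
    using that by simp
qed (use assms in \<open>simp add: linear_HQ_def\<close>)

lemma linear_a_nabla_b_xi: "linear_HQ a_nabla_b_xi"
  unfolding linear_HQ_def a_nabla_b_xi_def
  by (simp add: extend_scalars_add extend_scalars_scale scale_add scale_scale ac_simps)

lemma linear_HQ_funpow:
  assumes "linear_HQ f"
  shows "linear_HQ (f ^^ n)"
  using assms by (induction n) (simp_all add: linear_HQ_def)

lemma counit_eq_lookup: "counit x = Poly_Mapping.lookup x 1"
  by (simp add: counit_def in_keys_iff if_distrib cong: if_cong)

section \<open>Powers of the operator on Schubert symbols\<close>

lemma martial_schubert:
  "martial m (schubert \<pi>) = (if m \<in> descents \<pi> then schubert (r m * \<pi>) else 0)"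
  by (simp add: martial_def bruhat_less_r_mult_iff)

lemma nabla_schubert:
  "nabla (schubert \<pi>) = (\<Sum>m\<in>descents \<pi>. frag_cmul m (schubert (r m * \<pi>)))"
  unfolding nabla_def
  \<comment> \<open>The descents are finite, so the default value of \<open>Sum_any\<close> is
    avoided. They may exceed the support: the summand at \<open>m = 0\<close> vanishes even at a
    descent.\<close>
  by (subst Sum_any.expand_superset[of "descents \<pi>"]) (auto simp: martial_schubert)

lemma xi_schubert: "xi (schubert \<pi>) = (\<Sum>m\<in>descents \<pi>. schubert (r m * \<pi>))"
  unfolding xi_def
  by (subst Sum_any.expand_superset[of "descents \<pi>"]) (auto simp: martial_schubert)

lemma a_nabla_b_xi_basis:
  "a_nabla_b_xi (basis \<pi>) =
    (\<Sum>m\<in>descents \<pi>. scale (var_a * of_int m + var_b) (basis (r m * \<pi>)))"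
  by (simp add: a_nabla_b_xi_def extend_scalars_basis nabla_schubert xi_schubert embed_sum
      embed_frag_cmul embed_schubert scale_sum scale_scale scale_add_left sum.distrib)

text \<open>Peeling off the innermost application leaves a lower power acting on basis elements, as
  induction on \<open>n\<close> with \<open>\<pi>\<close> arbitrary requires.\<close>

lemma funpow_a_nabla_b_xi_basis:
  "(a_nabla_b_xi ^^ Suc n) (basis \<pi>) =
    (\<Sum>m\<in>descents \<pi>.
      scale (var_a * of_int m + var_b) ((a_nabla_b_xi ^^ n) (basis (r m * \<pi>))))"
proof -
  note lin = linear_HQ_funpow[OF linear_a_nabla_b_xi, of n]
  show ?thesis
    by (simp only: funpow_Suc_right o_apply a_nabla_b_xi_basis linear_HQ_sum[OF lin]
        linear_HQ_scale[OF lin])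
qed

text \<open>Each application lowers the length by one; this truncates the exponential.\<close>

lemma funpow_a_nabla_b_xi_eq_0:
  "cox_length \<pi> < n \<Longrightarrow> (a_nabla_b_xi ^^ n) (basis \<pi>) = 0"
proof (induction n arbitrary: \<pi>)
  case (Suc n)
  then have "(a_nabla_b_xi ^^ n) (basis (r m * \<pi>)) = 0" if "m \<in> descents \<pi>" for m
    using that by (simp add: cox_length_descent)
  then show ?case unfolding funpow_a_nabla_b_xi_basis by simp
qed simp

lemma counit_funpow_a_nabla_b_xi:
  "counit ((a_nabla_b_xi ^^ n) (basis \<pi>)) = (if cox_length \<pi> = n then RW_weight \<pi> else 0)"
proof (induction n arbitrary: \<pi>)
  case 0
  then show ?case by (simp add: counit_eq_lookup lookup_basis RW_weight_one)
next
  case (Suc n)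
  have "counit ((a_nabla_b_xi ^^ Suc n) (basis \<pi>)) =
      (\<Sum>m\<in>descents \<pi>. (var_a * of_int m + var_b) *
        (if cox_length (r m * \<pi>) = n then RW_weight (r m * \<pi>) else 0))"
    unfolding funpow_a_nabla_b_xi_basis using Suc.IH
    by (simp add: counit_eq_lookup lookup_sum)
  also have "\<dots> = (\<Sum>m\<in>descents \<pi>. if cox_length \<pi> = Suc n
      then (var_a * of_int m + var_b) * RW_weight (r m * \<pi>) else 0)"
    by (rule sum.cong) (auto simp: cox_length_descent)
  also have "\<dots> = (if cox_length \<pi> = Suc n then RW_weight \<pi> else 0)"
    \<comment> \<open>The recursion excludes the identity, but its length 0 is not a successor, so
      both sides vanish there.\<close>
    using RW_weight_unfold[of \<pi>] by (cases "\<pi> = 1") auto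
  finally show ?case .
qed

section \<open>The exponential on an arbitrary element\<close>

theorem theorem7:
  shows "counit \<circ> exp_a_nabla_b_xi = genus"
proof
  fix h :: H
  \<comment> \<open>A common length bound on the support of \<open>h\<close>; inserting 0 keeps the
    maximum meaningful for \<open>h = 0\<close>.\<close>
  define N where "N = Max (insert 0 (cox_length ` Poly_Mapping.keys h))"
  define c where "c \<pi> = (of_int (Poly_Mapping.lookup h \<pi>) :: Qab)" for \<pi>
  have len: "cox_length \<pi> \<le> N" if "\<pi> \<in> Poly_Mapping.keys h" for \<pi>
    using that by (simp add: N_def)
  have pow: "(a_nabla_b_xi ^^ n) (embed h) =
      (\<Sum>\<pi>\<in>Poly_Mapping.keys h. scale (c \<pi>) ((a_nabla_b_xi ^^ n) (basis \<pi>)))" for n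
  proof -
    note lin = linear_HQ_funpow[OF linear_a_nabla_b_xi, of n]
    show ?thesis
      by (simp only: embed_expand linear_HQ_sum[OF lin] linear_HQ_scale[OF lin] c_def)
  qed
  have "(a_nabla_b_xi ^^ n) (embed h) = 0" if "N < n" for n
    using that len unfolding pow
    by (intro sum.neutral) (force simp: funpow_a_nabla_b_xi_eq_0)
  then have "exp_a_nabla_b_xi h =
      (\<Sum>n\<le>N. scale (const_Qab (1 / fact n)) ((a_nabla_b_xi ^^ n) (embed h)))"
    unfolding exp_a_nabla_b_xi_def
    by (intro Sum_any.expand_superset) (auto, metis not_le scale_zero)
  then have "counit (exp_a_nabla_b_xi h) =
      (\<Sum>n\<le>N. const_Qab (1 / fact n) *
        (\<Sum>\<pi>\<in>Poly_Mapping.keys h. c \<pi> * counit ((a_nabla_b_xi ^^ n) (basis \<pi>))))"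
    by (simp add: pow counit_eq_lookup lookup_sum)
  \<comment> \<open>After the exchange of sums, only \<open>n = cox_length \<pi>\<close> survives
    for each \<open>\<pi>\<close>, which turns the exponential coefficient into the factor in the
    genus.\<close>
  also have "\<dots> = (\<Sum>\<pi>\<in>Poly_Mapping.keys h. \<Sum>n\<le>N.
      if n = cox_length \<pi> then c \<pi> * (const_Qab (1 / fact n) * RW_weight \<pi>) else 0)"
    by (subst sum.swap)
      (auto simp: counit_funpow_a_nabla_b_xi sum_distrib_left mult.left_commute intro!: sum.cong)
  also have "\<dots> = genus h"
    \<comment> \<open>\<open>len\<close> ensures that the surviving index lies in the range up to
      \<open>N\<close>.\<close>
    using len by (simp add: genus_def genus_schubert_def RW_weight_def c_def)
  finally show "(counit \<circ> exp_a_nabla_b_xi) h = genus h" by simp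
qed

end
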